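(* Let $$\mathrm{GF}_{\Lambda_{\{1_R\}}}(y_1,y_2,y_3):=\sum_{\lambda\in\Lambda_{\{1_R\}}} y_1^{\mathrm{len}_R(\lambda)}\,y_2^{\mathrm{len}_G(\lambda)}\,y_3^{\mathrm{len}_B(\lambda)}\,q^{|\lambda|}$$ and $$T(y_1,y_2,y_3):=\sum_{n_1,n_2,n_3\ge 0} q^{3\binom{n_1}{2}+\binom{n_2}{2}+\binom{n_3}{2}+n_1n_2+n_2n_3+n_3n_1}\,\frac{y_1^{n_1}y_2^{n_2}y_3^{n_3}\,(-q;q)_{n_1+n_2+n_3}}{(q^2;q^2)_{n_1}(q^2;q^2)_{n_2}(q^2;q^2)_{n_3}}.$$ Then $$\mathrm{GF}_{\Lambda_{\{1_R\}}}(y^2,y,y)=(1+yq)\,T(y^2q^4,\,yq^2,\,yq).$$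
   Context: A three-colored partition is a finite (possibly empty) partition into positive integer parts in which each part is assigned one of three colors: red, green, blue, indicated by subscripts $R,G,B$ (so $j_R$ is a red part of size $j$, etc.). For a three-colored partition $\lambda$, $|\lambda|$ is the sum of its parts, and $\mathrm{len}_R(\lambda),\mathrm{len}_G(\lambda),\mathrm{len}_B(\lambda)$ are the numbers of red, green and blue parts, respectively. $\Lambda$ is the set of three-colored partitions (including the empty one) such that: (i) each part size, counting all three colors together, appears at most once; (ii) for every $j\ge 1$, none of the following pairs of parts both occur: $j_R$ and $(j+1)_R$; $j_R$ and $(j+2)_R$; $j_R$ and $(j+1)_B$; $j_G$ and $(j+1)_R$; $j_G$ and $(j+2)_R$; $j_G$ and $(j+1)_B$; $j_B$ and $(j+1)_R$; $j_B$ and $(j+1)_G$. $\Lambda_{\{1_R\}}$ is the subset of $\Lambda$ consisting of the partitions in which the part $1_R$ does not occur. The $q$-Pochhammer symbol is $(A;q)_n:=\prod_{k=0}^{n-1}(1-Aq^k)$ for $n\in\mathbb{N}\cup\{\infty\}$. The identity is between formal power series in $y,q$. *)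

theory Defs
  imports "HOL-Analysis.Analysis"
begin

text \<open>
  Formal power series in \<open>y\<close> and \<open>q\<close> are elements of \<open>\<rat>[[y]][[q]]\<close>: the outer variable
  is \<open>q\<close>, the inner one is \<open>y\<close>. Infinite sums are unordered sums in the library topology of
  formal power series, which on this type is the \<open>q\<close>-adic one.
\<close>

type_synonym yq_series = "rat fps fps"

definition q :: yq_series where "q = fps_X"

definition y :: yq_series where "y = fps_const fps_X"

definition qpochhammer :: "yq_series \<Rightarrow> yq_series \<Rightarrow> nat \<Rightarrow> yq_series" where
  "qpochhammer A p n = (\<Prod>k<n. 1 - A * p ^ k)"

datatype color = Red | Green | Blue

text \<open>A colored part is a pair of its size and its color.\<close>

type_synonym colored_multiset = "(nat \<times> color) multiset"

definition three_colored_partition :: "colored_multiset \<Rightarrow> bool" where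
  "three_colored_partition \<mu> \<longleftrightarrow> (\<forall>p\<in>#\<mu>. fst p \<ge> 1)"

definition weight :: "colored_multiset \<Rightarrow> nat" where
  "weight \<mu> = (\<Sum>p\<in>#\<mu>. fst p)"

definition len :: "color \<Rightarrow> colored_multiset \<Rightarrow> nat" where
  "len c \<mu> = size (filter_mset (\<lambda>p. snd p = c) \<mu>)"

definition forbidden_pairs :: "nat \<Rightarrow> ((nat \<times> color) \<times> (nat \<times> color)) set" where
  "forbidden_pairs j =
     {((j, Red), (j + 1, Red)),
      ((j, Red), (j + 2, Red)),
      ((j, Red), (j + 1, Blue)),
      ((j, Green), (j + 1, Red)),
      ((j, Green), (j + 2, Red)),
      ((j, Green), (j + 1, Blue)),
      ((j, Blue), (j + 1, Red)),
      ((j, Blue), (j + 1, Green))}"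

definition \<Lambda> :: "colored_multiset set" where
  "\<Lambda> = {\<mu>. three_colored_partition \<mu> \<and>
            (\<forall>j\<ge>1. size (filter_mset (\<lambda>p. fst p = j) \<mu>) \<le> 1) \<and>
            (\<forall>j\<ge>1. \<forall>(a, b) \<in> forbidden_pairs j. \<not> (a \<in># \<mu> \<and> b \<in># \<mu>))}"

definition \<Lambda>_no_1R :: "colored_multiset set" where
  "\<Lambda>_no_1R = {\<mu> \<in> \<Lambda>. (1, Red) \<notin># \<mu>}"

definition GF_term :: "yq_series \<Rightarrow> yq_series \<Rightarrow> yq_series \<Rightarrow> colored_multiset \<Rightarrow> yq_series" where
  "GF_term y1 y2 y3 \<mu> =
     y1 ^ len Red \<mu> * y2 ^ len Green \<mu> * y3 ^ len Blue \<mu> * q ^ weight \<mu>"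

definition GF :: "colored_multiset set \<Rightarrow> yq_series \<Rightarrow> yq_series \<Rightarrow> yq_series \<Rightarrow> yq_series" where
  "GF S y1 y2 y3 = (\<Sum>\<^sub>\<infinity>\<mu>\<in>S. GF_term y1 y2 y3 \<mu>)"

text \<open>
  The denominators have constant coefficient \<open>1\<close>, so \<^const>\<open>inverse\<close> is their genuine
  multiplicative inverse (the coefficient ring \<open>\<rat>[[y]]\<close> is not a field, so division is not used).
\<close>

definition T_term :: "yq_series \<Rightarrow> yq_series \<Rightarrow> yq_series \<Rightarrow> nat \<times> nat \<times> nat \<Rightarrow> yq_series" where
  "T_term y1 y2 y3 = (\<lambda>(n1, n2, n3).
     q ^ (3 * (n1 choose 2) + (n2 choose 2) + (n3 choose 2) + n1 * n2 + n2 * n3 + n3 * n1) *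
     (y1 ^ n1 * y2 ^ n2 * y3 ^ n3 * qpochhammer (- q) q (n1 + n2 + n3)) *
     inverse (qpochhammer (q\<^sup>2) (q\<^sup>2) n1 * qpochhammer (q\<^sup>2) (q\<^sup>2) n2 * qpochhammer (q\<^sup>2) (q\<^sup>2) n3))"

definition T :: "yq_series \<Rightarrow> yq_series \<Rightarrow> yq_series \<Rightarrow> yq_series" where
  "T y1 y2 y3 = (\<Sum>\<^sub>\<infinity>n\<in>UNIV. T_term y1 y2 y3 n)"

text \<open>
  Well-definedness: the inverse is a true inverse, and both families are summable for all
  arguments, so that neither \<^const>\<open>inverse\<close> nor \<^const>\<open>infsum\<close> takes a default value.
\<close>

lemma T_denominator_inverse:
  fixes n1 n2 n3 :: nat
  defines "D \<equiv> qpochhammer (q\<^sup>2) (q\<^sup>2) n1 * qpochhammer (q\<^sup>2) (q\<^sup>2) n2 * qpochhammer (q\<^sup>2) (q\<^sup>2) n3"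
  shows "D * inverse D = 1"
proof -
  have "fps_nth (qpochhammer (q\<^sup>2) (q\<^sup>2) n) 0 = 1" for n
    by (induction n) (simp_all add: qpochhammer_def q_def fps_mult_nth_0)
  then have "fps_nth D 0 = 1"
    by (simp add: D_def fps_mult_nth_0)
  then show ?thesis
    unfolding fps_inverse_def by (intro fps_right_inverse) simp
qed

lemma fps_summable_onI:
  fixes f :: "'i \<Rightarrow> 'a::comm_ring_1 fps"
  assumes "\<And>n. finite {i \<in> A. fps_nth (f i) n \<noteq> 0}"
  shows "f summable_on A"
proof -
  let ?S = "\<lambda>n. {i \<in> A. fps_nth (f i) n \<noteq> 0}"
  let ?s = "Abs_fps (\<lambda>n. \<Sum>i\<in>?S n. fps_nth (f i) n)"
  have "(sum f \<longlongrightarrow> ?s) (finite_subsets_at_top A)"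
    unfolding tendsto_fps_iff
  proof
    fix n
    show "\<forall>\<^sub>F F in finite_subsets_at_top A. fps_nth (sum f F) n = fps_nth ?s n"
      unfolding eventually_finite_subsets_at_top
    proof (intro exI[of _ "?S n"] conjI allI impI)
      fix F assume F: "finite F \<and> ?S n \<subseteq> F \<and> F \<subseteq> A"
      have "(\<Sum>i\<in>?S n. fps_nth (f i) n) = (\<Sum>i\<in>F. fps_nth (f i) n)"
        using F by (intro sum.mono_neutral_left) auto
      then show "fps_nth (sum f F) n = fps_nth ?s n"
        by (simp add: fps_sum_nth)
    qed (use assms in auto)
  qed
  then show ?thesis
    unfolding summable_on_def has_sum_def by blast
qed

lemma finite_color: "finite (UNIV :: color set)"
proof -
  have "(UNIV :: color set) = {Red, Green, Blue}"
    using color.exhaust by auto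
  then show ?thesis by (metis finite.simps)
qed

lemma finite_\<Lambda>_weight_le: "finite {\<mu> \<in> \<Lambda>. weight \<mu> \<le> n}"
proof (rule finite_subset)
  show "finite (mset_set ` Pow ({1..n} \<times> (UNIV :: color set)))"
    by (intro finite_imageI) (simp add: finite_color)
  show "{\<mu> \<in> \<Lambda>. weight \<mu> \<le> n} \<subseteq> mset_set ` Pow ({1..n} \<times> UNIV)"
  proof
    fix \<mu> assume l: "\<mu> \<in> {\<mu> \<in> \<Lambda>. weight \<mu> \<le> n}"
    have part: "j \<in> {1..n}" if "(j, c) \<in># \<mu>" for j c
    proof -
      have "j \<le> weight \<mu>"
        using that unfolding weight_def by (auto dest!: multi_member_split)
      moreover have "j \<ge> 1"
        using l that by (auto simp: \<Lambda>_def three_colored_partition_def)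
      ultimately show ?thesis using l by auto
    qed
    have once: "count \<mu> p = 1" if "p \<in># \<mu>" for p
    proof -
      have "fst p \<ge> 1" using part[of "fst p" "snd p"] that by auto
      then have "size (filter_mset (\<lambda>p'. fst p' = fst p) \<mu>) \<le> 1"
        using l by (auto simp: \<Lambda>_def)
      moreover have "count (filter_mset (\<lambda>p'. fst p' = fst p) \<mu>) p \<le>
          size (filter_mset (\<lambda>p'. fst p' = fst p) \<mu>)"
        by (rule count_le_size)
      ultimately have "count \<mu> p \<le> 1" by simp
      with that show ?thesis by (simp add: count_greater_zero_iff[symmetric] del: count_greater_zero_iff)
    qed
    have "\<mu> = mset_set (set_mset \<mu>)"
      by (rule multiset_eqI) (metis once count_mset_set(1,3) finite_set_mset not_in_iff)
    moreover have "set_mset \<mu> \<in> Pow ({1..n} \<times> UNIV)" using part by auto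
    ultimately show "\<mu> \<in> mset_set ` Pow ({1..n} \<times> UNIV)" by blast
  qed
qed

lemma GF_term_summable:
  assumes "S \<subseteq> \<Lambda>"
  shows "GF_term y1 y2 y3 summable_on S"
proof (rule fps_summable_onI)
  fix n
  have "{\<mu> \<in> S. fps_nth (GF_term y1 y2 y3 \<mu>) n \<noteq> 0} \<subseteq> {\<mu> \<in> \<Lambda>. weight \<mu> \<le> n}"
    using assms by (auto simp: GF_term_def q_def fps_X_power_mult_right_nth split: if_splits)
  then show "finite {\<mu> \<in> S. fps_nth (GF_term y1 y2 y3 \<mu>) n \<noteq> 0}"
    using finite_\<Lambda>_weight_le by (rule finite_subset)
qed

lemma T_term_summable: "T_term y1 y2 y3 summable_on UNIV"
proof (rule fps_summable_onI)
  fix n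
  have ch: "k \<le> (k choose 2) + 1" for k
    by (cases k) (simp_all add: numeral_2_eq_2)
  have "{t \<in> UNIV. fps_nth (T_term y1 y2 y3 t) n \<noteq> 0} \<subseteq> {..n+1} \<times> {..n+1} \<times> {..n+1}"
  proof
    fix t assume t: "t \<in> {t \<in> UNIV. fps_nth (T_term y1 y2 y3 t) n \<noteq> 0}"
    obtain n1 n2 n3 where t_eq: "t = (n1, n2, n3)" by (cases t)
    from t have "3 * (n1 choose 2) + (n2 choose 2) + (n3 choose 2) + n1 * n2 + n2 * n3 + n3 * n1 \<le> n"
      by (auto simp: t_eq T_term_def q_def mult.assoc fps_X_power_mult_nth split: if_splits)
    with ch[of n1] ch[of n2] ch[of n3] have "n1 \<le> n + 1 \<and> n2 \<le> n + 1 \<and> n3 \<le> n + 1"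
      by linarith
    then show "t \<in> {..n+1} \<times> {..n+1} \<times> {..n+1}"
      by (simp add: t_eq)
  qed
  then show "finite {t \<in> UNIV. fps_nth (T_term y1 y2 y3 t) n \<noteq> 0}"
    by (rule finite_subset) simp
qed

end

theory Submission
  imports Defs
begin

text \<open>
  Let \<open>D\<^sub>k\<close> be the generating function of the partitions in \<open>\<Lambda>\<close> with parts exceeding \<open>k\<close> and without
  the part \<open>(k + 1)\<^sub>R\<close>, and \<open>A\<^sub>k\<close> that of the partitions that may follow a red or green part of size
  \<open>k\<close>, both at \<open>(y\<^sup>2, y, y)\<close>. Removing the smallest part gives a linear recurrence for the pair
  \<open>(A\<^sub>k, D\<^sub>k)\<close>, whose solution is unique since both series tend to \<open>1\<close>. It is
  \<open>D\<^sub>k = \<Sum>\<^sub>j y\<^sup>j q\<^bsup>j\<^sup>2 + k j\<^esup> (-y q;q)\<^sub>j (-y q\<^bsup>k + j + 1\<^esup>;q)\<^sub>\<infinity> / (q;q)\<^sub>j\<close>, and \<open>A\<^sub>k\<close> has an additional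
  factor \<open>q\<^sup>j\<close> in the summand. In particular
  \<open>D\<^sub>0 = (-y q;q)\<^sub>\<infinity> \<Sum>\<^sub>j y\<^sup>j q\<^bsup>j\<^sup>2\<^esup> / (q;q)\<^sub>j\<close>.
  On the other side, the sum over \<open>n\<^sub>2 + n\<^sub>3 = N\<close> in \<open>T(y\<^sup>2 q\<^sup>4, y q\<^sup>2, y q)\<close> collapses by
  \<open>\<Sum>\<^sub>a q\<^sup>a / ((q\<^sup>2;q\<^sup>2)\<^sub>a (q\<^sup>2;q\<^sup>2)\<^bsub>N - a\<^esub>) = 1 / (q;q)\<^sub>N\<close>, and two applications of the q-binomial theorem
  and one of Euler's identity reduce the remaining double sum to the same series.
\<close>

subsection \<open>Infinite sums of formal power series\<close>

text \<open>Each coefficient is locally constant in this topology, hence so are finitely many at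
  once. This suffices for the two instances below, since a coefficient of a sum or product depends
  on finitely many coefficients of the arguments.\<close>

lemma eventually_nhds_fps_nth:
  fixes c :: "'a::group_add fps"
  shows "\<forall>\<^sub>F f in nhds c. \<forall>i\<le>n. fps_nth f i = fps_nth c i"
proof -
  have "\<forall>\<^sub>F f in nhds c. \<forall>i\<in>{..n}. fps_nth f i = fps_nth c i"
    using filterlim_ident[of "nhds c"] by (intro eventually_ball_finite) (auto simp: tendsto_fps_iff)
  then show ?thesis by (auto elim: eventually_mono)
qed

instance fps :: (ab_group_add) topological_comm_monoid_add
proof
  fix a b :: "'a fps"
  show "((\<lambda>x. fst x + snd x) \<longlongrightarrow> a + b) (nhds a \<times>\<^sub>F nhds b)"
    unfolding tendsto_fps_iff
  proof
    fix n
    show "\<forall>\<^sub>F x in nhds a \<times>\<^sub>F nhds b. fps_nth (fst x + snd x) n = fps_nth (a + b) n"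
      unfolding eventually_prod_filter
      by (intro exI conjI, rule eventually_nhds_fps_nth[of n a], rule eventually_nhds_fps_nth[of n b])
        simp
  qed
qed

instance fps :: (ring) topological_semigroup_mult
proof
  fix a b :: "'a fps"
  show "((\<lambda>x. fst x * snd x) \<longlongrightarrow> a * b) (nhds a \<times>\<^sub>F nhds b)"
    unfolding tendsto_fps_iff
  proof
    fix n
    show "\<forall>\<^sub>F x in nhds a \<times>\<^sub>F nhds b. fps_nth (fst x * snd x) n = fps_nth (a * b) n"
      unfolding eventually_prod_filter
      by (intro exI conjI, rule eventually_nhds_fps_nth[of n a], rule eventually_nhds_fps_nth[of n b])
        (auto simp: fps_mult_nth intro!: sum.cong)
  qed
qed

section \<open>Summability from growing powers of \<open>q\<close>\<close>

lemma q_power_nth: "fps_nth (q ^ e * f) n = (if n < e then 0 else fps_nth f (n - e))"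
  by (simp add: q_def fps_X_power_mult_nth)

lemma summable_on_q_powerI:
  assumes "\<And>i. i \<in> A \<Longrightarrow> f i = q ^ e i * g i" and "\<And>n. finite {i \<in> A. e i \<le> n}"
  shows "f summable_on A"
proof (rule fps_summable_onI)
  fix n
  have "{i \<in> A. fps_nth (f i) n \<noteq> 0} \<subseteq> {i \<in> A. e i \<le> n}"
    by (auto simp: assms(1) q_power_nth split: if_splits)
  then show "finite {i \<in> A. fps_nth (f i) n \<noteq> 0}"
    using assms(2) by (rule finite_subset)
qed

text \<open>The slack of \<open>1\<close> accommodates the exponent \<open>i choose 2\<close>, which
  is smaller than \<open>i\<close> at \<open>1\<close> and \<open>2\<close>.\<close>

lemma summable_on_q_power_natI:
  fixes e :: "nat \<Rightarrow> nat"
  assumes "\<And>i. f i = q ^ e i * g i" and "\<And>i. i \<le> e i + 1"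
  shows "f summable_on UNIV"
proof (rule summable_on_q_powerI)
  show "finite {i \<in> UNIV. e i \<le> n}" for n
  proof (rule finite_subset)
    show "{i \<in> UNIV. e i \<le> n} \<subseteq> {..n + 1}"
      using assms(2) by (auto intro: order_trans)
  qed simp
qed (rule assms(1))

text \<open>Meant for terms with a factor \<open>1 - q ^ n\<close>: there \<open>f 0\<close>
  vanishes and only the shifted sum remains.\<close>

lemma has_sum_nat_shift:
  fixes f :: "nat \<Rightarrow> 'a::topological_comm_monoid_add"
  assumes "((\<lambda>n. f (Suc n)) has_sum s) UNIV"
  shows "(f has_sum (f 0 + s)) UNIV"
proof -
  have "(f has_sum s) (range Suc)"
    using assms by (subst has_sum_reindex) (auto simp: o_def)
  moreover have "(f has_sum f 0) {0}"
    using has_sum_finite[of "{0}" f] by simp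
  ultimately have "(f has_sum (f 0 + s)) ({0} \<union> range Suc)"
    by (intro has_sum_Un_disjoint) auto
  moreover have "{0} \<union> range Suc = UNIV"
    by (auto simp: image_iff) (metis not0_implies_Suc)
  ultimately show ?thesis by simp
qed

text \<open>The index set is the disjoint union of the fibres of \<open>p\<close>. Summability of
  the whole family has to be assumed, since convergent fibre sums would not imply it.\<close>

lemma has_sum_group:
  fixes f :: "'a \<Rightarrow> 'c::{topological_comm_monoid_add,t3_space}"
  assumes f: "(f has_sum s) UNIV"
    and fibre: "\<And>b. (f has_sum g b) {x. p x = b}"
  shows "(g has_sum s) UNIV"
proof (rule has_sum_SigmaD)
  have "(f \<circ> snd has_sum s) (Sigma UNIV (\<lambda>b. {x. p x = b}))"
  proof (subst has_sum_reindex[symmetric])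
    show "inj_on snd (Sigma UNIV (\<lambda>b. {x. p x = b}))"
      by (auto simp: inj_on_def)
    have "snd ` Sigma UNIV (\<lambda>b. {x. p x = b}) = UNIV"
      by (auto simp: image_iff)
    then show "(f has_sum s) (snd ` Sigma UNIV (\<lambda>b. {x. p x = b}))"
      using f by simp
  qed
  then show "(f \<circ> snd has_sum s) (Sigma UNIV (\<lambda>b. {x. p x = b}))" .
  show "((\<lambda>x. (f \<circ> snd) (b, x)) has_sum g b) {x. p x = b}" for b
    using fibre by simp
qed

lemma has_sum_antidiagonal:
  fixes f :: "nat \<times> nat \<Rightarrow> 'c::{topological_comm_monoid_add,t3_space}"
  assumes "(f has_sum s) UNIV"
  shows "((\<lambda>N. \<Sum>a\<le>N. f (a, N - a)) has_sum s) UNIV"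
proof (rule has_sum_group[OF assms, where p = "\<lambda>(a, b). a + b"])
  fix N :: nat
  have "{x. (case x of (a, b) \<Rightarrow> a + b) = N} = (\<lambda>a. (a, N - a)) ` {..N}"
    by (auto simp: image_iff)
  then show "(f has_sum (\<Sum>a\<le>N. f (a, N - a))) {x. (case x of (a, b) \<Rightarrow> a + b) = N}"
    by (auto simp: sum.reindex inj_on_def intro!: has_sum_finiteI)
qed

lemma has_sum_antidiagonal':
  fixes f :: "'a \<times> nat \<times> nat \<Rightarrow> 'c::{topological_comm_monoid_add,t3_space}"
  assumes "(f has_sum s) UNIV"
  shows "((\<lambda>(n, N). \<Sum>a\<le>N. f (n, a, N - a)) has_sum s) UNIV"
proof (rule has_sum_group[OF assms, where p = "\<lambda>(n, a, b). (n, a + b)"])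
  fix z :: "'a \<times> nat"
  obtain n N where z: "z = (n, N)" by (cases z)
  have "{x. (case x of (n, a, b) \<Rightarrow> (n, a + b)) = z} = (\<lambda>a. (n, a, N - a)) ` {..N}"
    by (auto simp: image_iff z)
  then show "(f has_sum (case z of (n, N) \<Rightarrow> \<Sum>a\<le>N. f (n, a, N - a)))
      {x. (case x of (n, a, b) \<Rightarrow> (n, a + b)) = z}"
    by (auto simp: z sum.reindex inj_on_def intro!: has_sum_finiteI)
qed

subsection \<open>Finite \<open>q\<close>-series\<close>

lemma qpochhammer_0 [simp]: "qpochhammer a p 0 = 1"
  by (simp add: qpochhammer_def)

lemma qpochhammer_Suc: "qpochhammer a p (Suc n) = qpochhammer a p n * (1 - a * p ^ n)"
  by (simp add: qpochhammer_def)

lemma qpochhammer_Suc_shift: "qpochhammer a p (Suc n) = (1 - a) * qpochhammer (a * p) p n"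
  by (simp only: qpochhammer_def prod.lessThan_Suc_shift) (simp add: mult.assoc)

lemma qpochhammer_add:
  "qpochhammer a p (m + n) = qpochhammer a p m * qpochhammer (a * p ^ m) p n"
  by (induction n) (simp_all add: qpochhammer_Suc power_add mult.assoc)

lemma qpochhammer_square:
  "qpochhammer (a\<^sup>2) (p\<^sup>2) n = qpochhammer a p n * qpochhammer (- a) p n"
  by (induction n) (simp_all add: qpochhammer_Suc power2_eq_square power_mult_distrib algebra_simps)

lemma qpochhammer_mult_inverse:
  assumes "r > 0"
  shows "qpochhammer (q ^ r) p n * inverse (qpochhammer (q ^ r) p n) = 1"
proof -
  have "fps_nth (qpochhammer (q ^ r) p n) 0 = 1"
    using assms by (induction n) (simp_all add: qpochhammer_Suc fps_mult_nth_0 q_def)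
  then show ?thesis
    unfolding fps_inverse_def by (intro fps_right_inverse) simp
qed

text \<open>The coefficients do not form a field, so identities between reciprocals are derived from
  uniqueness of inverses.\<close>

lemma inverse_unique_comm_monoid:
  fixes a b c :: "'a::comm_monoid_mult"
  assumes "a * b = 1" "a * c = 1"
  shows "b = c"
proof -
  have "b = b * (a * c)" by (simp add: assms)
  also have "\<dots> = (a * b) * c" by (simp only: mult_ac)
  finally show ?thesis by (simp add: assms)
qed

definition rq :: "nat \<Rightarrow> yq_series" where
  "rq n = inverse (qpochhammer q q n)"

definition rqq :: "nat \<Rightarrow> yq_series" where
  "rqq n = inverse (qpochhammer (q\<^sup>2) (q\<^sup>2) n)"

lemma qpochhammer_rq: "qpochhammer q q n * rq n = 1"
  using qpochhammer_mult_inverse[of 1 q n] by (simp add: rq_def)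

lemma qpochhammer_rqq: "qpochhammer (q\<^sup>2) (q\<^sup>2) n * rqq n = 1"
  using qpochhammer_mult_inverse[of 2 "q\<^sup>2" n] by (simp add: rqq_def)

lemma rq_unique: "qpochhammer q q n * f = 1 \<Longrightarrow> f = rq n"
  using qpochhammer_rq by (rule inverse_unique_comm_monoid[rotated])

lemma rqq_unique: "qpochhammer (q\<^sup>2) (q\<^sup>2) n * f = 1 \<Longrightarrow> f = rqq n"
  using qpochhammer_rqq by (rule inverse_unique_comm_monoid[rotated])

lemma rq_0 [simp]: "rq 0 = 1" and rqq_0 [simp]: "rqq 0 = 1"
  using qpochhammer_rq[of 0] qpochhammer_rqq[of 0] by simp_all

lemma rq_Suc: "(1 - q ^ Suc n) * rq (Suc n) = rq n"
  by (rule rq_unique) (use qpochhammer_rq[of "Suc n"] in \<open>simp add: qpochhammer_Suc mult_ac\<close>)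

lemma rqq_Suc: "(1 - q ^ (2 * Suc n)) * rqq (Suc n) = rqq n"
  unfolding power_mult
  by (rule rqq_unique) (use qpochhammer_rqq[of "Suc n"] in \<open>simp add: qpochhammer_Suc mult_ac\<close>)

text \<open>Cancellation in (q^2;q^2)_n = (q;q)_n (-q;q)_n.\<close>

lemma rqq_mult_qpochhammer: "qpochhammer (- q) q n * rqq n = rq n"
  by (rule rq_unique) (use qpochhammer_rqq[of n] in \<open>simp add: qpochhammer_square mult.assoc\<close>)

lemma inverse_rqq:
  "inverse (qpochhammer (q\<^sup>2) (q\<^sup>2) n1 * qpochhammer (q\<^sup>2) (q\<^sup>2) n2 * qpochhammer (q\<^sup>2) (q\<^sup>2) n3)
    = rqq n1 * rqq n2 * rqq n3" (is "inverse ?D = ?r")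
proof -
  have "?D * ?r = (qpochhammer (q\<^sup>2) (q\<^sup>2) n1 * rqq n1) * (qpochhammer (q\<^sup>2) (q\<^sup>2) n2 * rqq n2)
      * (qpochhammer (q\<^sup>2) (q\<^sup>2) n3 * rqq n3)"
    by (simp only: mult_ac)
  then have "?D * ?r = 1" by (simp add: qpochhammer_rqq)
  then show ?thesis
    by (rule inverse_unique_comm_monoid[OF T_denominator_inverse])
qed

lemma one_minus_q_power_neq_0: "1 - q ^ Suc n \<noteq> 0"
proof
  assume "1 - q ^ Suc n = 0"
  then have "fps_nth (1 - q ^ Suc n) 0 = 0" by simp
  then show False by (simp add: q_def)
qed

text \<open>The q-binomial theorem divided by (q;q)_N. Splitting \<open>1 - q ^ Suc N\<close> as
  \<open>(1 - q ^ (Suc N - k)) + q ^ (Suc N - k) * (1 - q ^ k)\<close> lets each piece cancel a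
  factor of one reciprocal, so both sides satisfy the same first-order recurrence in
  \<open>N\<close>.\<close>

lemma q_binomial:
  "(\<Sum>k\<le>N. a ^ k * q ^ (k choose 2) * rq k * rq (N - k)) = qpochhammer (- a) q N * rq N"
proof (induction N)
  case 0
  then show ?case by (simp add: numeral_2_eq_2)
next
  case (Suc N)
  let ?g = "\<lambda>k M. a ^ k * q ^ (k choose 2) * rq k * rq M"
  let ?R = "\<lambda>N. \<Sum>k\<le>N. ?g k (N - k)"
  have left: "(1 - q ^ (Suc N - k)) * ?g k (Suc N - k) = ?g k (N - k)" if "k \<le> N" for k
    using rq_Suc[of "N - k"] that by (simp add: Suc_diff_le mult_ac del: power_Suc)
  have right: "q ^ (N - k) * (1 - q ^ Suc k) * ?g (Suc k) (N - k) = a * q ^ N * ?g k (N - k)"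
    if "k \<le> N" for k
  proof -
    have "q ^ (N - k) * (1 - q ^ Suc k) * ?g (Suc k) (N - k) =
        q ^ (N - k) * a ^ Suc k * q ^ (Suc k choose 2) * ((1 - q ^ Suc k) * rq (Suc k)) * rq (N - k)"
      by (simp only: mult_ac)
    also have "\<dots> = a * (q ^ (N - k) * q ^ k) * ?g k (N - k)"
      unfolding rq_Suc by (simp add: numeral_2_eq_2 power_add mult_ac)
    finally show ?thesis using that by (simp flip: power_add)
  qed
  have "(1 - q ^ Suc N) * ?R (Suc N) =
      (\<Sum>k\<le>Suc N. (1 - q ^ (Suc N - k)) * ?g k (Suc N - k) +
        q ^ (Suc N - k) * (1 - q ^ k) * ?g k (Suc N - k))"
    unfolding sum_distrib_left
  proof (intro sum.cong refl)
    fix k assume "k \<in> {..Suc N}"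
    then have "q ^ Suc N = q ^ (Suc N - k) * q ^ k" by (simp flip: power_add)
    then show "(1 - q ^ Suc N) * ?g k (Suc N - k) = (1 - q ^ (Suc N - k)) * ?g k (Suc N - k) +
        q ^ (Suc N - k) * (1 - q ^ k) * ?g k (Suc N - k)"
      by (simp only:) (simp add: algebra_simps)
  qed
  also have "\<dots> = (\<Sum>k\<le>Suc N. (1 - q ^ (Suc N - k)) * ?g k (Suc N - k)) +
      (\<Sum>k\<le>Suc N. q ^ (Suc N - k) * (1 - q ^ k) * ?g k (Suc N - k))"
    by (rule sum.distrib)
  also have "(\<Sum>k\<le>Suc N. (1 - q ^ (Suc N - k)) * ?g k (Suc N - k)) = ?R N"
    by (simp add: left del: power_Suc)
  \<comment> \<open>The summand at \<open>k = 0\<close> vanishes, and the others are shifted down by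
    one.\<close>
  also have "(\<Sum>k\<le>Suc N. q ^ (Suc N - k) * (1 - q ^ k) * ?g k (Suc N - k)) = a * q ^ N * ?R N"
    unfolding sum.atMost_Suc_shift sum_distrib_left diff_Suc_Suc
    by (simp only: power_0 diff_self mult_zero_right mult_zero_left add_0_left)
      (intro sum.cong refl right, simp)
  also have "?R N + a * q ^ N * ?R N = (1 + a * q ^ N) * ?R N"
    by (simp add: algebra_simps)
  also have "\<dots> = (1 - q ^ Suc N) * (qpochhammer (- a) q (Suc N) * rq (Suc N))"
    unfolding Suc.IH rq_Suc[of N, symmetric] by (simp add: qpochhammer_Suc mult_ac)
  finally show ?case
    using one_minus_q_power_neq_0 by (simp only: mult_cancel_left) blast
qed

text \<open>Reversing the order of summation in \<open>q ^ Suc N * ?S (Suc N)\<close> turns the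
  extra power into \<open>q ^ (2 * (Suc N - a))\<close>. Subtracted from \<open>?S (Suc N)\<close>,
  this leaves the factor that lowers the second reciprocal to index \<open>N - a\<close>.\<close>

lemma sum_rqq: "(\<Sum>a\<le>N. q ^ a * rqq a * rqq (N - a)) = rq N"
proof (induction N)
  case 0
  then show ?case by simp
next
  case (Suc N)
  let ?S = "\<lambda>N. \<Sum>a\<le>N. q ^ a * rqq a * rqq (N - a)"
  have step: "(1 - q ^ (2 * (Suc N - a))) * rqq (Suc N - a) = rqq (N - a)" if "a \<le> N" for a
    using rqq_Suc[of "N - a"] that by (simp add: Suc_diff_le)
  have "q ^ Suc N * ?S (Suc N) = (\<Sum>a\<le>Suc N. q ^ (Suc N - a) * q ^ a * (q ^ a * rqq a * rqq (Suc N - a)))"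
    unfolding sum_distrib_left by (intro sum.cong refl) (simp flip: power_add)
  also have "\<dots> = (\<Sum>a\<le>Suc N. q ^ a * rqq a * (q ^ (2 * (Suc N - a)) * rqq (Suc N - a)))"
    by (rule sum.reindex_bij_witness[of _ "\<lambda>a. Suc N - a" "\<lambda>a. Suc N - a"])
      (auto simp: mult_2_right power_add mult_ac)
  also have "\<dots> = ?S (Suc N) - (\<Sum>a\<le>Suc N. q ^ a * rqq a * ((1 - q ^ (2 * (Suc N - a))) * rqq (Suc N - a)))"
    unfolding sum_subtractf[symmetric] by (intro sum.cong refl) (simp add: algebra_simps)
  also have "(\<Sum>a\<le>Suc N. q ^ a * rqq a * ((1 - q ^ (2 * (Suc N - a))) * rqq (Suc N - a))) = ?S N"
    by (simp add: step)
  finally have "(1 - q ^ Suc N) * ?S (Suc N) = ?S N"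
    by (simp add: algebra_simps)
  also have "\<dots> = (1 - q ^ Suc N) * rq (Suc N)"
    using Suc.IH rq_Suc[of N] by simp
  finally show ?case
    using one_minus_q_power_neq_0 by (simp only: mult_cancel_left) blast
qed

subsection \<open>Recurrences for the generating functions\<close>

definition avoiding :: "nat \<Rightarrow> (nat \<times> color) set \<Rightarrow> colored_multiset set" where
  "avoiding k S = {\<mu> \<in> \<Lambda>. \<forall>p\<in>#\<mu>. k < fst p \<and> p \<notin> S}"

definition excluded_after :: "nat \<times> color \<Rightarrow> (nat \<times> color) set" where
  "excluded_after p = {p'. (p, p') \<in> forbidden_pairs (fst p)}"

definition color_var :: "color \<Rightarrow> yq_series" where
  "color_var c = (case c of Red \<Rightarrow> y\<^sup>2 | Green \<Rightarrow> y | Blue \<Rightarrow> y)"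

lemma color_UNIV: "(UNIV :: color set) = {Red, Green, Blue}"
  using color.exhaust by auto

lemma avoiding_subset: "avoiding k S \<subseteq> \<Lambda>"
  by (auto simp: avoiding_def)

lemma avoiding_cong:
  assumes "\<And>p. k < fst p \<Longrightarrow> p \<in> S \<longleftrightarrow> p \<in> S'"
  shows "avoiding k S = avoiding k S'"
  using assms by (auto simp: avoiding_def)

lemma forbidden_pairs_less: "(a, b) \<in> forbidden_pairs j \<Longrightarrow> fst a = j \<and> j < fst b"
  by (auto simp: forbidden_pairs_def)

text \<open>Every forbidden pair lists its smaller part first, so a new smallest part can enter such
  a pair only as the first component.\<close>

lemma add_mset_in_\<Lambda>_iff:
  assumes "j \<ge> 1" and large: "\<And>p. p \<in># \<nu> \<Longrightarrow> j < fst p"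
  shows "add_mset (j, c) \<nu> \<in> \<Lambda> \<longleftrightarrow> \<nu> \<in> \<Lambda> \<and> (\<forall>p\<in>#\<nu>. p \<notin> excluded_after (j, c))"
proof -
  let ?\<mu> = "add_mset (j, c) \<nu>"
  have empty: "filter_mset (\<lambda>p. fst p = j) \<nu> = {#}"
    using large by (fastforce simp: multiset_eq_iff count_eq_zero_iff)
  have size: "size (filter_mset (\<lambda>p. fst p = i) ?\<mu>) \<le> 1 \<longleftrightarrow>
      size (filter_mset (\<lambda>p. fst p = i) \<nu>) \<le> 1" for i
    by (cases "i = j") (simp_all add: empty)
  have pairs: "(\<forall>i\<ge>1. \<forall>(a, b)\<in>forbidden_pairs i. \<not> (a \<in># ?\<mu> \<and> b \<in># ?\<mu>)) \<longleftrightarrow>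
      (\<forall>i\<ge>1. \<forall>(a, b)\<in>forbidden_pairs i. \<not> (a \<in># \<nu> \<and> b \<in># \<nu>)) \<and>
      (\<forall>p\<in>#\<nu>. p \<notin> excluded_after (j, c))" (is "?l \<longleftrightarrow> ?r \<and> ?s")
  proof (intro iffI conjI)
    show ?r if ?l using that by fastforce
    show ?s if ?l using that assms(1) by (fastforce simp: excluded_after_def)
    show ?l if rs: "?r \<and> ?s"
    proof (intro allI impI ballI, clarify)
      fix i a1 a2 b1 b2
      assume i: "i \<ge> 1" and ab: "((a1, a2), (b1, b2)) \<in> forbidden_pairs i"
        and a: "(a1, a2) \<in># ?\<mu>" and b: "(b1, b2) \<in># ?\<mu>"
      note less = forbidden_pairs_less[OF ab]
      have "(b1, b2) \<in># \<nu>"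
        using a b less large[of "(a1, a2)"] by auto
      moreover have "(a1, a2) \<notin># \<nu>"
        using rs i ab calculation by blast
      ultimately show False
        using rs a ab less by (auto simp: excluded_after_def)
    qed
  qed
  show ?thesis
    using assms(1) unfolding \<Lambda>_def three_colored_partition_def mem_Collect_eq size pairs
    by (auto dest: less_imp_le)
qed

text \<open>Size \<open>Suc k\<close> is the smallest one possible and occurs at most once, so the
  cases are its absence and its three colors.\<close>

lemma avoiding_Suc:
  "avoiding k S = avoiding (Suc k) S \<union>
     (\<Union>c\<in>{c. (Suc k, c) \<notin> S}.
        add_mset (Suc k, c) ` avoiding (Suc k) (S \<union> excluded_after (Suc k, c)))"
proof (intro equalityI subsetI)
  fix \<mu> assume \<mu>: "\<mu> \<in> avoiding k S"
  show "\<mu> \<in> avoiding (Suc k) S \<union>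
     (\<Union>c\<in>{c. (Suc k, c) \<notin> S}.
        add_mset (Suc k, c) ` avoiding (Suc k) (S \<union> excluded_after (Suc k, c)))"
  proof (cases "\<exists>c. (Suc k, c) \<in># \<mu>")
    case False
    then have "Suc k < fst p" if "p \<in># \<mu>" for p
      using \<mu> that by (metis (mono_tags, lifting) Suc_lessI avoiding_def mem_Collect_eq surjective_pairing)
    then show ?thesis using \<mu> by (auto simp: avoiding_def)
  next
    case True
    then obtain c \<nu> where \<nu>: "\<mu> = add_mset (Suc k, c) \<nu>"
      by (metis multi_member_split)
    have "size (filter_mset (\<lambda>p. fst p = Suc k) \<mu>) \<le> 1"
      using \<mu> by (auto simp: avoiding_def \<Lambda>_def)
    then have "filter_mset (\<lambda>p. fst p = Suc k) \<nu> = {#}"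
      by (simp add: \<nu>)
    then have "fst p \<noteq> Suc k" if "p \<in># \<nu>" for p
      using that by (auto simp: filter_mset_eq_conv dest: multi_member_split)
    moreover have "k < fst p" if "p \<in># \<nu>" for p
      using \<mu> that by (auto simp: \<nu> avoiding_def)
    ultimately have large: "Suc k < fst p" if "p \<in># \<nu>" for p
      using that by (metis Suc_lessI)
    then have "\<nu> \<in> avoiding (Suc k) (S \<union> excluded_after (Suc k, c))" "(Suc k, c) \<notin> S"
      using \<mu> add_mset_in_\<Lambda>_iff[of "Suc k" \<nu> c] by (auto simp: \<nu> avoiding_def)
    then show ?thesis using \<nu> by blast
  qed
next
  fix \<mu> assume "\<mu> \<in> avoiding (Suc k) S \<union>
     (\<Union>c\<in>{c. (Suc k, c) \<notin> S}.
        add_mset (Suc k, c) ` avoiding (Suc k) (S \<union> excluded_after (Suc k, c)))"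
  then consider "\<mu> \<in> avoiding (Suc k) S"
    | c \<nu> where "(Suc k, c) \<notin> S" "\<mu> = add_mset (Suc k, c) \<nu>"
        "\<nu> \<in> avoiding (Suc k) (S \<union> excluded_after (Suc k, c))"
    by blast
  then show "\<mu> \<in> avoiding k S"
  proof cases
    case 1
    then show ?thesis by (auto simp: avoiding_def)
  next
    case 2
    then show ?thesis
      using add_mset_in_\<Lambda>_iff[of "Suc k" \<nu> c] by (auto simp: avoiding_def dest: Suc_lessD)
  qed
qed

lemma GF_term_add_mset:
  "GF_term (y\<^sup>2) y y (add_mset (j, c) \<mu>) = color_var c * q ^ j * GF_term (y\<^sup>2) y y \<mu>"
  by (cases c) (simp_all add: GF_term_def len_def weight_def color_var_def power_add mult_ac)

abbreviation G :: "nat \<Rightarrow> (nat \<times> color) set \<Rightarrow> yq_series" where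
  "G k S \<equiv> GF (avoiding k S) (y\<^sup>2) y y"

lemma has_sum_G: "(GF_term (y\<^sup>2) y y has_sum G k S) (avoiding k S)"
  unfolding GF_def by (intro has_sum_infsum GF_term_summable avoiding_subset)

lemma G_Suc_sum:
  "G k S = G (Suc k) S + (\<Sum>c | (Suc k, c) \<notin> S.
     color_var c * q ^ Suc k * G (Suc k) (S \<union> excluded_after (Suc k, c)))"
proof -
  let ?A = "\<lambda>c. avoiding (Suc k) (S \<union> excluded_after (Suc k, c))"
  let ?C = "{c. (Suc k, c) \<notin> S}"
  have sum_c: "(GF_term (y\<^sup>2) y y has_sum color_var c * q ^ Suc k * G (Suc k) (S \<union> excluded_after (Suc k, c)))
      (add_mset (Suc k, c) ` ?A c)" for c
    by (subst has_sum_reindex)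
      (auto simp: o_def inj_on_def GF_term_add_mset simp del: power_Suc intro!: has_sum_cmult_right has_sum_G)
  have no_part: "(Suc k, c) \<notin># \<mu>" if "\<mu> \<in> avoiding (Suc k) S'" for c \<mu> S'
    using that by (auto simp: avoiding_def)
  have "(GF_term (y\<^sup>2) y y has_sum (\<Sum>c\<in>?C. color_var c * q ^ Suc k *
      G (Suc k) (S \<union> excluded_after (Suc k, c)))) (\<Union>c\<in>?C. add_mset (Suc k, c) ` ?A c)"
  proof (rule sum_has_sum[OF _ sum_c])
    show "finite ?C"
      using finite_color by (rule finite_subset[rotated]) simp
    fix c c' :: color assume "c \<noteq> c'"
    then show "add_mset (Suc k, c) ` ?A c \<inter> add_mset (Suc k, c') ` ?A c' = {}"
      by (auto simp: avoiding_def add_eq_conv_ex)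
  qed
  moreover have "avoiding (Suc k) S \<inter> (\<Union>c\<in>?C. add_mset (Suc k, c) ` ?A c) = {}"
    using no_part by fastforce
  ultimately have "(GF_term (y\<^sup>2) y y has_sum (G (Suc k) S + (\<Sum>c\<in>?C. color_var c * q ^ Suc k *
      G (Suc k) (S \<union> excluded_after (Suc k, c))))) (avoiding k S)"
    unfolding avoiding_Suc[of k S] by (intro has_sum_Un_disjoint has_sum_G)
  with has_sum_G show ?thesis
    by (rule has_sum_unique)
qed

lemma G_Suc:
  "G k S = G (Suc k) S
    + (if (Suc k, Red) \<in> S then 0
       else y\<^sup>2 * q ^ Suc k * G (Suc k) (S \<union> excluded_after (Suc k, Red)))
    + (if (Suc k, Green) \<in> S then 0
       else y * q ^ Suc k * G (Suc k) (S \<union> excluded_after (Suc k, Green)))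
    + (if (Suc k, Blue) \<in> S then 0
       else y * q ^ Suc k * G (Suc k) (S \<union> excluded_after (Suc k, Blue)))"
proof -
  have "(\<Sum>c | (Suc k, c) \<notin> S. f c) = (\<Sum>c\<in>UNIV. if (Suc k, c) \<in> S then 0 else f c)"
    for f :: "color \<Rightarrow> yq_series"
    using finite_color by (intro sum.mono_neutral_cong_left) auto
  then show ?thesis
    by (subst G_Suc_sum) (simp add: color_UNIV color_var_def add.assoc del: power_Suc)
qed

lemma excluded_after_Red [simp]:
    "excluded_after (j, Red) = {(Suc j, Red), (Suc (Suc j), Red), (Suc j, Blue)}"
  and excluded_after_Green [simp]:
    "excluded_after (j, Green) = {(Suc j, Red), (Suc (Suc j), Red), (Suc j, Blue)}"
  and excluded_after_Blue [simp]:
    "excluded_after (j, Blue) = {(Suc j, Red), (Suc j, Green)}"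
  by (auto simp: excluded_after_def forbidden_pairs_def)

text \<open>
  A red and a green part of size \<open>k\<close> exclude the same larger parts, so four states suffice for the
  parts exceeding \<open>k\<close>: after a red or green part of size \<open>k\<close> (\<open>A\<close>), after a blue part of size \<open>k\<close>
  (\<open>B\<close>), unrestricted (\<open>C\<close>), and the restriction of the theorem shifted by \<open>k\<close> (\<open>D\<close>).
\<close>

definition G\<^sub>A :: "nat \<Rightarrow> yq_series" where
  "G\<^sub>A k = G k {(Suc k, Red), (Suc (Suc k), Red), (Suc k, Blue)}"

definition G\<^sub>B :: "nat \<Rightarrow> yq_series" where
  "G\<^sub>B k = G k {(Suc k, Red), (Suc k, Green)}"

definition G\<^sub>C :: "nat \<Rightarrow> yq_series" where
  "G\<^sub>C k = G k {}"

definition G\<^sub>D :: "nat \<Rightarrow> yq_series" where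
  "G\<^sub>D k = G k {(Suc k, Red)}"

text \<open>Drops exclusions of sizes up to \<open>k\<close>, which are void. This brings the sets
  produced by \<open>G_Suc\<close> back to the four states.\<close>

lemma G_cong:
  assumes "\<And>p. k < fst p \<Longrightarrow> p \<in> S \<longleftrightarrow> p \<in> S'"
  shows "G k S = G k S'"
  using avoiding_cong[OF assms] by simp

lemma G\<^sub>A_Suc: "G\<^sub>A k = G\<^sub>D (Suc k) + y * q ^ Suc k * G\<^sub>A (Suc k)"
  unfolding G\<^sub>A_def G\<^sub>D_def
  by (subst G_Suc)
    (auto simp del: power_Suc intro!: arg_cong2[where f = "(+)"] arg_cong2[where f = "(*)"] G_cong)

lemma G\<^sub>B_Suc: "G\<^sub>B k = G\<^sub>C (Suc k) + y * q ^ Suc k * G\<^sub>B (Suc k)"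
  unfolding G\<^sub>B_def G\<^sub>C_def
  by (subst G_Suc)
    (auto simp del: power_Suc intro!: arg_cong2[where f = "(+)"] arg_cong2[where f = "(*)"] G_cong)

lemma G\<^sub>C_Suc:
  "G\<^sub>C k = G\<^sub>C (Suc k) + y\<^sup>2 * q ^ Suc k * G\<^sub>A (Suc k) + y * q ^ Suc k * G\<^sub>A (Suc k)
     + y * q ^ Suc k * G\<^sub>B (Suc k)"
  unfolding G\<^sub>A_def G\<^sub>B_def G\<^sub>C_def
  by (subst G_Suc) (simp del: power_Suc)

lemma G\<^sub>D_Suc:
  "G\<^sub>D k = G\<^sub>C (Suc k) + y * q ^ Suc k * G\<^sub>A (Suc k) + y * q ^ Suc k * G\<^sub>B (Suc k)"
  unfolding G\<^sub>A_def G\<^sub>B_def G\<^sub>C_def G\<^sub>D_def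
  by (subst G_Suc)
    (auto simp del: power_Suc intro!: arg_cong2[where f = "(+)"] arg_cong2[where f = "(*)"] G_cong)

text \<open>States \<open>B\<close> and \<open>C\<close> are eliminated: compared with
  \<open>G\<^sub>D k\<close>, the first also excludes a green part of size \<open>Suc k\<close> and
  the second readmits a red one. Either way the parts after it are counted by
  \<open>G\<^sub>A (Suc k)\<close>.\<close>

lemma G\<^sub>D_recurrence:
  "G\<^sub>D k = (1 + y * q ^ Suc k) * G\<^sub>D (Suc k) + y * q ^ Suc k * G\<^sub>A (Suc k)
     + y\<^sup>2 * q ^ Suc (Suc k) * (1 - q ^ Suc k) * G\<^sub>A (Suc (Suc k))"
proof -
  have B: "G\<^sub>B k = G\<^sub>D k - y * q ^ Suc k * G\<^sub>A (Suc k)" for k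
    using G\<^sub>B_Suc[of k] G\<^sub>D_Suc[of k] by (simp add: algebra_simps)
  have C: "G\<^sub>C k = G\<^sub>D k + y\<^sup>2 * q ^ Suc k * G\<^sub>A (Suc k)" for k
    using G\<^sub>C_Suc[of k] G\<^sub>D_Suc[of k] by (simp add: algebra_simps)
  show ?thesis
    using G\<^sub>D_Suc[of k] unfolding B C by (simp add: algebra_simps power2_eq_square)
qed

section \<open>Initial conditions: convergence of the generating functions to
  \<open>1\<close>\<close>

lemma eq_empty_if_weight_le:
  assumes "\<mu> \<in> \<Lambda>" "weight \<mu> \<le> k" "\<forall>p\<in>#\<mu>. k < fst p"
  shows "\<mu> = {#}"
proof (rule ccontr)
  assume "\<mu> \<noteq> {#}"
  then obtain p \<nu> where "\<mu> = add_mset p \<nu>" by (metis multiset_cases)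
  then show False using assms by (auto simp: weight_def)
qed

lemma G_nth:
  assumes "i \<le> k"
  shows "fps_nth (G k S) i = fps_nth 1 i"
proof -
  let ?f = "GF_term (y\<^sup>2) y y"
  have "{#} \<in> avoiding k S"
    by (simp add: avoiding_def \<Lambda>_def three_colored_partition_def)
  moreover have "fps_nth (?f \<mu>) i = 0" if "\<mu> \<in> avoiding k S" "\<mu> \<noteq> {#}" for \<mu>
    using that assms eq_empty_if_weight_le[of \<mu> k]
    by (auto simp: avoiding_def GF_term_def q_def fps_X_power_mult_right_nth)
  ultimately have "(\<Sum>\<mu> | \<mu> \<in> avoiding k S \<and> fps_nth (?f \<mu>) i \<noteq> 0. fps_nth (?f \<mu>) i) =
      (\<Sum>\<mu>\<in>{{#}}. fps_nth (?f \<mu>) i)"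
    by (intro sum.mono_neutral_left) auto
  then show ?thesis
    by (simp add: has_sum_fpsD(2)[OF has_sum_G] GF_term_def len_def weight_def)
qed

subsection \<open>Solution of the recurrences\<close>

lemma choose_two_add: "(m + n) choose 2 = (m choose 2) + (n choose 2) + m * n"
  by (induction n) (simp_all add: numeral_2_eq_2)

lemma choose_two_double: "2 * (n choose 2) + n = n * n"
  by (induction n) (simp_all add: numeral_2_eq_2)

definition euler_term :: "nat \<Rightarrow> nat \<Rightarrow> yq_series" where
  "euler_term k i = q ^ ((i choose 2) + k * i) * (y ^ i * rq i)"

text \<open>By Euler's identity this is the infinite product \<open>(-y q\<^sup>k; q)\<^sub>\<infinity>\<close>.\<close>

definition euler_sum :: "nat \<Rightarrow> yq_series" where
  "euler_sum k = infsum (euler_term k) UNIV"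

lemma le_choose_two_Suc: "n \<le> (n choose 2) + 1"
  by (cases n) (simp_all add: numeral_2_eq_2)

lemma has_sum_euler: "(euler_term k has_sum euler_sum k) UNIV"
  unfolding euler_sum_def
proof (intro has_sum_infsum summable_on_q_power_natI)
  show "euler_term k i = q ^ ((i choose 2) + k * i) * (y ^ i * rq i)" for i
    by (rule euler_term_def)
  show "i \<le> (i choose 2) + k * i + 1" for i
    using le_choose_two_Suc[of i] by simp
qed

text \<open>The functional equation of the infinite product, read off the series:
  \<open>euler_term (Suc k) i\<close> is \<open>q ^ i * euler_term k i\<close>, and the remaining
  \<open>(1 - q ^ i) * euler_term k i\<close> is a shifted term with argument
  \<open>Suc k\<close>.\<close>

lemma euler_sum_Suc: "euler_sum k = (1 + y * q ^ k) * euler_sum (Suc k)"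
proof -
  define f where "f i = (1 - q ^ i) * euler_term k i" for i
  have "f (Suc i) = y * q ^ k * euler_term (Suc k) i" for i
  proof -
    have "f (Suc i) = q ^ ((Suc i choose 2) + k * Suc i) * y ^ Suc i * ((1 - q ^ Suc i) * rq (Suc i))"
      by (simp add: f_def euler_term_def mult_ac)
    also have "\<dots> = y * q ^ k * euler_term (Suc k) i"
      unfolding rq_Suc by (simp add: euler_term_def numeral_2_eq_2 power_add mult_ac)
    finally show ?thesis .
  qed
  then have "((\<lambda>i. f (Suc i)) has_sum y * q ^ k * euler_sum (Suc k)) UNIV"
    by (simp add: has_sum_cmult_right has_sum_euler)
  then have "(f has_sum y * q ^ k * euler_sum (Suc k)) UNIV"
    using has_sum_nat_shift[of f] by (simp add: f_def)
  from has_sum_add[OF has_sum_euler[of "Suc k"] this]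
  have "((\<lambda>i. euler_term (Suc k) i + f i) has_sum (1 + y * q ^ k) * euler_sum (Suc k)) UNIV"
    by (simp add: algebra_simps)
  moreover have "euler_term (Suc k) i + f i = euler_term k i" for i
    by (simp add: f_def euler_term_def algebra_simps power_add)
  ultimately show ?thesis
    using has_sum_euler[of k] has_sum_unique by simp
qed

section \<open>Contiguous relations for the Rogers-Ramanujan type sums\<close>

definition rr_term :: "nat \<Rightarrow> nat \<Rightarrow> yq_series" where
  "rr_term k j = q ^ (j * j + k * j) * (y ^ j * qpochhammer (- (y * q)) q j * rq j)"

lemma rr_term_Suc: "rr_term (Suc k) j = q ^ j * rr_term k j"
  by (simp add: rr_term_def power_add mult_ac)

lemma rr_term_step:
  "(1 - q ^ Suc j) * rr_term k (Suc j) = y * q ^ (2 * j + 1 + k) * (1 + y * q ^ Suc j) * rr_term k j"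
proof -
  have "(1 - q ^ Suc j) * rr_term k (Suc j) =
      q ^ (Suc j * Suc j + k * Suc j) * y ^ Suc j * qpochhammer (- (y * q)) q (Suc j) *
      ((1 - q ^ Suc j) * rq (Suc j))"
    by (simp add: rr_term_def mult_ac)
  also have "\<dots> = y * q ^ (2 * j + 1 + k) * (1 + y * q ^ Suc j) * rr_term k j"
    unfolding rq_Suc qpochhammer_Suc
    by (simp add: rr_term_def power_add power_mult_distrib mult_ac power2_eq_square mult_2_right)
  finally show ?thesis .
qed

text \<open>
  At \<open>m = 1\<close> this is \<open>(-y q;q)\<^sub>\<infinity> \<Sum>\<^sub>j y\<^sup>j q\<^bsup>j\<^sup>2 + k j\<^esup> / (q;q)\<^sub>j\<close>, a Rogers-Ramanujan sum.
\<close>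

definition rr_sum :: "nat \<Rightarrow> nat \<Rightarrow> yq_series" where
  "rr_sum k m = (\<Sum>\<^sub>\<infinity>j. rr_term k j * euler_sum (m + j))"

lemma has_sum_rr: "((\<lambda>j. rr_term k j * euler_sum (m + j)) has_sum rr_sum k m) UNIV"
  unfolding rr_sum_def
  by (intro has_sum_infsum summable_on_q_power_natI[where e = "\<lambda>j. j * j + k * j"])
    (auto simp: rr_term_def mult.assoc intro: trans_le_add1 le_trans[OF le_square])

lemma has_sum_rr_q_power:
  "((\<lambda>j. q ^ (l * j) * rr_term k j * euler_sum (m + j)) has_sum rr_sum (l + k) m) UNIV"
proof -
  have "q ^ (l * j) * rr_term k j = rr_term (l + k) j" for j
    by (simp add: rr_term_def power_add algebra_simps)
  then show ?thesis using has_sum_rr[of "l + k" m] by simp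
qed

text \<open>The factor \<open>1 - q ^ j\<close> removes the term at \<open>0\<close> and lowers the
  index by \<open>rr_term_step\<close>; the factor \<open>1 + y * q ^ Suc j\<close> that appears
  there splits the result into two sums.\<close>

lemma has_sum_rr_step:
  "((\<lambda>j. (1 - q ^ j) * rr_term k j * euler_sum (m + j)) has_sum
     y * q ^ Suc k * (rr_sum (k + 2) (Suc m) + y * q * rr_sum (k + 3) (Suc m))) UNIV"
proof -
  have "y * q ^ Suc k * (q ^ (2 * j) * rr_term k j * euler_sum (Suc m + j) +
      y * q * (q ^ (3 * j) * rr_term k j * euler_sum (Suc m + j))) =
    (1 - q ^ Suc j) * rr_term k (Suc j) * euler_sum (m + Suc j)" for j
    unfolding rr_term_step by (simp add: power_add algebra_simps mult_2_right power2_eq_square numeral_3_eq_3)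
  moreover have "((\<lambda>j. y * q ^ Suc k * (q ^ (2 * j) * rr_term k j * euler_sum (Suc m + j) +
      y * q * (q ^ (3 * j) * rr_term k j * euler_sum (Suc m + j)))) has_sum
     y * q ^ Suc k * (rr_sum (2 + k) (Suc m) + y * q * rr_sum (3 + k) (Suc m))) UNIV"
    by (intro has_sum_cmult_right has_sum_add has_sum_rr_q_power)
  ultimately have "((\<lambda>j. (1 - q ^ Suc j) * rr_term k (Suc j) * euler_sum (m + Suc j)) has_sum
     y * q ^ Suc k * (rr_sum (2 + k) (Suc m) + y * q * rr_sum (3 + k) (Suc m))) UNIV"
    by simp
  from has_sum_nat_shift[of "\<lambda>j. (1 - q ^ j) * rr_term k j * euler_sum (m + j)", OF this]
  show ?thesis by (simp add: add.commute)
qed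

text \<open>Split \<open>1\<close> as \<open>(1 - q ^ j) + q ^ j\<close> in each summand.\<close>

lemma rr_sum_step:
  "rr_sum k m = rr_sum (k + 1) m
     + y * q ^ Suc k * (rr_sum (k + 2) (Suc m) + y * q * rr_sum (k + 3) (Suc m))"
proof -
  have "(1 - q ^ j) * rr_term k j * euler_sum (m + j) + rr_term (k + 1) j * euler_sum (m + j)
      = rr_term k j * euler_sum (m + j)" for j
    by (simp add: rr_term_Suc algebra_simps)
  with has_sum_add[OF has_sum_rr_step[of k m] has_sum_rr[of "k + 1" m]] has_sum_rr[of k m]
  show ?thesis by (simp add: has_sum_unique add.commute)
qed

text \<open>Extract the first factor \<open>1 + y * q ^ (m + j)\<close> of each product.\<close>

lemma rr_sum_euler: "rr_sum k m = rr_sum k (Suc m) + y * q ^ m * rr_sum (k + 1) (Suc m)"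
proof -
  have "rr_term k j * euler_sum (Suc m + j) + y * q ^ m * (rr_term (k + 1) j * euler_sum (Suc m + j))
      = rr_term k j * euler_sum (m + j)" for j
    using euler_sum_Suc[of "m + j"] by (simp add: rr_term_Suc algebra_simps power_add)
  with has_sum_add[OF has_sum_rr[of k "Suc m"]
      has_sum_cmult_right[OF has_sum_rr[of "k + 1" "Suc m"], of "y * q ^ m"]] has_sum_rr[of k m]
  show ?thesis by (simp add: has_sum_unique)
qed

lemma has_sum_nth:
  fixes e :: "nat \<Rightarrow> nat"
  assumes "(f has_sum s) UNIV" "\<And>j. f j = q ^ e j * g j" "\<And>j. j > 0 \<Longrightarrow> i < e j"
  shows "fps_nth s i = fps_nth (f 0) i"
proof -
  have "(\<Sum>j | j \<in> UNIV \<and> fps_nth (f j) i \<noteq> 0. fps_nth (f j) i) = (\<Sum>j\<in>{0}. fps_nth (f j) i)"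
    using assms(2,3) by (intro sum.mono_neutral_left) (auto simp: q_power_nth)
  then show ?thesis using has_sum_fpsD(2)[OF assms(1)] by simp
qed

lemma rr_sum_nth:
  assumes "i \<le> k" "i < m"
  shows "fps_nth (rr_sum k m) i = fps_nth 1 i"
proof -
  have e: "i < j * j + k * j" if "j > 0" for j
    using that assms by (cases j) auto
  have e': "i < (j choose 2) + m * j" if "j > 0" for j
    using that assms by (cases j) auto
  have "fps_nth (rr_sum k m) i = fps_nth (euler_sum m) i"
    using has_sum_nth[OF has_sum_rr, where e = "\<lambda>j. j * j + k * j"
        and g = "\<lambda>j. y ^ j * qpochhammer (- (y * q)) q j * rq j * euler_sum (m + j)"] e
    by (simp add: rr_term_def mult.assoc)
  also have "\<dots> = fps_nth 1 i"
    using has_sum_nth[OF has_sum_euler euler_term_def e'] by (simp add: euler_term_def numeral_2_eq_2)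
  finally show ?thesis .
qed

text \<open>Coefficients up to \<open>n\<close> at index \<open>k\<close> vanish as soon as they do
  at the next two indices, and they vanish for \<open>k \<ge> n\<close>; hence the downward
  induction on \<open>n - k\<close>.\<close>

lemma series_pair_unique:
  assumes a: "\<And>k. a k = d (Suc k) + u k * a (Suc k)"
    and d: "\<And>k. d k = v k * d (Suc k) + u k * a (Suc k) + w k * a (Suc (Suc k))"
    and small: "\<And>k i. i \<le> k \<Longrightarrow> fps_nth (a k) i = 0 \<and> fps_nth (d k) i = 0"
  shows "a k = (0 :: 'a::comm_ring_1 fps) \<and> d k = 0"
proof -
  have "\<forall>i\<le>n. fps_nth (a k) i = 0 \<and> fps_nth (d k) i = 0" for n k
  proof (induction "n - k" arbitrary: k rule: less_induct)
    case less
    show ?case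
    proof (cases "n \<le> k")
      case True
      then show ?thesis using small by simp
    next
      case False
      then have IH: "\<forall>i\<le>n. fps_nth (a (Suc k)) i = 0 \<and> fps_nth (d (Suc k)) i = 0"
          "\<forall>i\<le>n. fps_nth (a (Suc (Suc k))) i = 0 \<and> fps_nth (d (Suc (Suc k))) i = 0"
        by (intro less; simp)+
      have mult0: "\<forall>i\<le>n. fps_nth (g * f) i = 0" if "\<forall>i\<le>n. fps_nth f i = 0" for f g :: "'a fps"
        using that by (auto simp: fps_mult_nth)
      show ?thesis
        unfolding a[of k] d[of k] using IH by (simp add: mult0)
    qed
  qed
  then show ?thesis by (auto simp: fps_eq_iff)
qed

text \<open>Counterpart of \<open>G\<^sub>D_recurrence\<close>. In this combination of the two
  contiguous relations the sums with first argument \<open>k + 4\<close> cancel.\<close>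

lemma rr_sum_recurrence:
  "rr_sum k (Suc k) = (1 + y * q ^ Suc k) * rr_sum (Suc k) (Suc (Suc k))
     + y * q ^ Suc k * rr_sum (Suc (Suc k)) (Suc (Suc k))
     + y\<^sup>2 * q ^ Suc (Suc k) * (1 - q ^ Suc k) * rr_sum (Suc (Suc (Suc k))) (Suc (Suc (Suc k)))"
  using rr_sum_step[of k "Suc k"] rr_sum_step[of "Suc k" "Suc (Suc k)"]
    rr_sum_euler[of "Suc k" "Suc k"] rr_sum_euler[of "Suc (Suc (Suc k))" "Suc (Suc k)"]
  by (simp add: numeral_2_eq_2 numeral_3_eq_3) (simp add: algebra_simps)

lemma G_eq_rr_sum:
  "G\<^sub>A k = rr_sum (Suc k) (Suc k) \<and> G\<^sub>D k = rr_sum k (Suc k)"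
proof -
  let ?a = "\<lambda>k. G\<^sub>A k - rr_sum (Suc k) (Suc k)" and ?d = "\<lambda>k. G\<^sub>D k - rr_sum k (Suc k)"
  have "?a k = 0 \<and> ?d k = 0"
  proof (rule series_pair_unique[where a = ?a and d = ?d and u = "\<lambda>k. y * q ^ Suc k"
        and v = "\<lambda>k. 1 + y * q ^ Suc k" and w = "\<lambda>k. y\<^sup>2 * q ^ Suc (Suc k) * (1 - q ^ Suc k)"])
    \<comment> \<open>For the \<open>rr_sum\<close> parts this is exactly
      \<open>rr_sum_euler\<close> with both arguments equal to \<open>Suc k\<close>.\<close>
    show "?a k = ?d (Suc k) + y * q ^ Suc k * ?a (Suc k)" for k
      using G\<^sub>A_Suc[of k] rr_sum_euler[of "Suc k" "Suc k"] by (simp add: algebra_simps)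
    show "?d k = (1 + y * q ^ Suc k) * ?d (Suc k) + y * q ^ Suc k * ?a (Suc k) +
        y\<^sup>2 * q ^ Suc (Suc k) * (1 - q ^ Suc k) * ?a (Suc (Suc k))" for k
      unfolding G\<^sub>D_recurrence[of k] rr_sum_recurrence[of k] right_diff_distrib by simp
    show "fps_nth (?a k) i = 0 \<and> fps_nth (?d k) i = 0" if "i \<le> k" for k i
      using that by (simp add: rr_sum_nth G\<^sub>A_def G\<^sub>D_def G_nth)
  qed
  then show ?thesis by simp
qed

lemma \<Lambda>_no_1R_eq: "\<Lambda>_no_1R = avoiding 0 {(Suc 0, Red)}"
  by (auto simp: \<Lambda>_no_1R_def avoiding_def \<Lambda>_def three_colored_partition_def)

subsection \<open>Evaluation of the triple sum\<close>

text \<open>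
  The summand of \<open>T\<close> after the sum over \<open>n\<^sub>2 + n\<^sub>3 = N\<close> has been evaluated and the remaining factor
  \<open>(-q\<^bsup>n + 1\<^esup>;q)\<^sub>N / (q;q)\<^sub>N\<close> has been expanded by the q-binomial theorem, with \<open>N = k + m\<close>.
\<close>

definition expanded_term :: "nat \<times> nat \<times> nat \<Rightarrow> yq_series" where
  "expanded_term = (\<lambda>(n, k, m).
     q ^ (3 * (n choose 2) + ((k + m) choose 2) + n * (k + m) + 4 * n + (k + m)
          + (n + 1) * k + (k choose 2)) *
     (y ^ (2 * n + k + m) * rq n * rq k * rq m))"

lemma summable_expanded_term: "expanded_term summable_on UNIV"
proof (rule summable_on_q_powerI)
  let ?e = "\<lambda>(n, k, m). 3 * (n choose 2) + ((k + m) choose 2) + n * (k + m) + 4 * n + (k + m)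
          + (n + 1) * k + (k choose 2)"
  show "expanded_term i = q ^ ?e i * (case i of (n, k, m) \<Rightarrow> y ^ (2 * n + k + m) * rq n * rq k * rq m)" for i
    by (cases i) (simp add: expanded_term_def)
  show "finite {i \<in> UNIV. ?e i \<le> B}" for B
  proof (rule finite_subset)
    \<comment> \<open>The linear part \<open>4 * n + (k + m)\<close> of the exponent already bounds
      all three indices.\<close>
    show "{i \<in> UNIV. ?e i \<le> B} \<subseteq> {..B} \<times> {..B} \<times> {..B}" by auto
  qed simp
qed

lemma sum_T_term:
  "(\<Sum>a\<le>N. T_term (y\<^sup>2 * q ^ 4) (y * q\<^sup>2) (y * q) (n, a, N - a)) =
   (\<Sum>k\<le>N. expanded_term (n, k, N - k))"
proof -
  let ?P = "qpochhammer (- q) q"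
  let ?c = "q ^ (3 * (n choose 2) + (N choose 2) + n * N + 4 * n + N) * y ^ (2 * n + N)"
  have T: "T_term (y\<^sup>2 * q ^ 4) (y * q\<^sup>2) (y * q) (n, a, N - a) =
      ?c * ?P (n + N) * rqq n * (q ^ a * rqq a * rqq (N - a))" if le: "a \<le> N" for a
  proof -
    obtain b where N: "N = a + b" using le_Suc_ex[OF le] by blast
    \<comment> \<open>The cross term \<open>a * b\<close> completes the two binomials to
      \<open>N choose 2\<close>; only \<open>q ^ a\<close> still depends on the splitting of
      \<open>N\<close>.\<close>
    have e: "4 * n + 2 * a + b + (3 * (n choose 2) + (a choose 2) + (b choose 2) + n * a + a * b + b * n)
      = 3 * (n choose 2) + (N choose 2) + n * N + 4 * n + N + a"
      unfolding N choose_two_add by (simp add: algebra_simps)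
    have args: "(y\<^sup>2 * q ^ 4) ^ n * (y * q\<^sup>2) ^ a * (y * q) ^ b = q ^ (4 * n + 2 * a + b) * y ^ (2 * n + a + b)"
      by (simp add: power_mult_distrib power_add mult_ac flip: power_mult)
    have "T_term (y\<^sup>2 * q ^ 4) (y * q\<^sup>2) (y * q) (n, a, b) =
        q ^ (3 * (n choose 2) + (a choose 2) + (b choose 2) + n * a + a * b + b * n) *
        (q ^ (4 * n + 2 * a + b) * y ^ (2 * n + a + b) * ?P (n + a + b)) * (rqq n * rqq a * rqq b)"
      unfolding T_term_def prod.case inverse_rqq args ..
    also have "\<dots> = q ^ (4 * n + 2 * a + b + (3 * (n choose 2) + (a choose 2) + (b choose 2) + n * a + a * b + b * n)) *
        y ^ (2 * n + N) * ?P (n + N) * (rqq n * rqq a * rqq b)"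
      by (simp add: N power_add mult_ac add.assoc)
    also have "\<dots> = ?c * ?P (n + N) * rqq n * (q ^ a * rqq a * rqq b)"
      unfolding e by (simp add: power_add mult_ac)
    finally show ?thesis by (simp add: N)
  qed
  have V: "expanded_term (n, k, N - k) =
      ?c * rq n * ((q ^ Suc n) ^ k * q ^ (k choose 2) * rq k * rq (N - k))" if le: "k \<le> N" for k
  proof -
    have e: "3 * (n choose 2) + ((k + (N - k)) choose 2) + n * (k + (N - k)) + 4 * n + (k + (N - k))
        + (n + 1) * k + (k choose 2) =
        3 * (n choose 2) + (N choose 2) + n * N + 4 * n + N + (Suc n * k + (k choose 2))"
      and ye: "2 * n + k + (N - k) = 2 * n + N"
      using le by simp_all
    show ?thesis
      unfolding expanded_term_def prod.case e ye power_mult[symmetric]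
      by (simp add: power_add mult_ac)
  qed
  have "(\<Sum>a\<le>N. T_term (y\<^sup>2 * q ^ 4) (y * q\<^sup>2) (y * q) (n, a, N - a)) =
      ?c * ?P (n + N) * rqq n * (\<Sum>a\<le>N. q ^ a * rqq a * rqq (N - a))"
    unfolding sum_distrib_left by (intro sum.cong refl T) simp
  \<comment> \<open>Splitting (-q;q)_{n+N} after \<open>n\<close> factors leaves a first block that
    turns \<open>rqq n\<close> into \<open>rq n\<close> and a second one for the q-binomial
    theorem.\<close>
  also have "\<dots> = ?c * (?P n * rqq n) * (qpochhammer (- (q ^ Suc n)) q N * rq N)"
    unfolding sum_rqq qpochhammer_add by (simp add: mult_ac)
  also have "\<dots> = ?c * rq n * (\<Sum>k\<le>N. (q ^ Suc n) ^ k * q ^ (k choose 2) * rq k * rq (N - k))"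
    unfolding rqq_mult_qpochhammer q_binomial ..
  also have "\<dots> = (\<Sum>k\<le>N. expanded_term (n, k, N - k))"
    unfolding sum_distrib_left by (intro sum.cong refl V[symmetric]) simp
  finally show ?thesis .
qed

text \<open>Both triple families have the same antidiagonal sums. As \<open>expanded_term\<close> is
  summable in its own right, uniqueness of the regrouped sum identifies its value.\<close>

lemma has_sum_expanded_term:
  "(expanded_term has_sum T (y\<^sup>2 * q ^ 4) (y * q\<^sup>2) (y * q)) UNIV"
proof -
  have "(T_term (y\<^sup>2 * q ^ 4) (y * q\<^sup>2) (y * q) has_sum T (y\<^sup>2 * q ^ 4) (y * q\<^sup>2) (y * q)) UNIV"
    unfolding T_def by (intro has_sum_infsum T_term_summable)
  from has_sum_antidiagonal'[OF this]
  have T: "((\<lambda>(n, N). \<Sum>k\<le>N. expanded_term (n, k, N - k)) has_sum T (y\<^sup>2 * q ^ 4) (y * q\<^sup>2) (y * q)) UNIV"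
    unfolding sum_T_term .
  have sum: "(expanded_term has_sum infsum expanded_term UNIV) UNIV"
    by (intro has_sum_infsum summable_expanded_term)
  with has_sum_unique[OF has_sum_antidiagonal'[OF sum] T] show ?thesis
    by simp
qed

text \<open>The exponent depends on \<open>m\<close> only through
  \<open>(m choose 2) + Suc (n + k) * m\<close>, so the sum over \<open>m\<close> is an Euler
  series.\<close>

lemma has_sum_expanded_term_last:
  "((\<lambda>m. expanded_term (n, k, m)) has_sum
     q ^ ((n + k) * (n + k) + (n + k) + (n choose 2) + 2 * n) *
     (y ^ (2 * n + k) * rq n * rq k) * euler_sum (Suc (n + k))) UNIV"
proof -
  have e: "3 * (n choose 2) + ((k + m) choose 2) + n * (k + m) + 4 * n + (k + m) + (n + 1) * k + (k choose 2)
    = (n + k) * (n + k) + (n + k) + (n choose 2) + 2 * n + ((m choose 2) + Suc (n + k) * m)" for m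
    using choose_two_double[of n] choose_two_double[of k]
    unfolding choose_two_add by (simp add: algebra_simps)
  have "expanded_term (n, k, m) = q ^ ((n + k) * (n + k) + (n + k) + (n choose 2) + 2 * n) *
     (y ^ (2 * n + k) * rq n * rq k) * euler_term (Suc (n + k)) m" for m
    unfolding expanded_term_def prod.case e by (simp add: euler_term_def power_add mult_ac)
  then show ?thesis
    by (simp add: has_sum_cmult_right has_sum_euler)
qed

lemma T_eq_rr_sum:
  "(1 + y * q) * T (y\<^sup>2 * q ^ 4) (y * q\<^sup>2) (y * q) = rr_sum 1 1 + y * q * rr_sum 2 1"
proof -
  let ?h = "\<lambda>(n, k). q ^ ((n + k) * (n + k) + (n + k) + (n choose 2) + 2 * n) *
     (y ^ (2 * n + k) * rq n * rq k) * euler_sum (Suc (n + k))"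
  let ?T = "T (y\<^sup>2 * q ^ 4) (y * q\<^sup>2) (y * q)"
  have "(?h has_sum ?T) UNIV"
  proof (rule has_sum_group[OF has_sum_expanded_term, where p = "\<lambda>(n, k, m). (n, k)"])
    fix z :: "nat \<times> nat"
    obtain n k where z: "z = (n, k)" by (cases z)
    have fibre: "{x. (case x of (n, k, m) \<Rightarrow> (n, k)) = z} = range (\<lambda>m. (n, k, m))"
      by (auto simp: z)
    show "(expanded_term has_sum ?h z) {x. (case x of (n, k, m) \<Rightarrow> (n, k)) = z}"
      unfolding fibre unfolding z prod.case
      by (subst has_sum_reindex)
        (simp_all only: o_def has_sum_expanded_term_last, simp add: inj_on_def)
  qed
  from has_sum_cmult_right[OF has_sum_antidiagonal[OF this], of "1 + y * q"]
  have "((\<lambda>j. (1 + y * q) * (\<Sum>n\<le>j. ?h (n, j - n))) has_sum (1 + y * q) * ?T) UNIV" .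
  moreover have "(1 + y * q) * (\<Sum>n\<le>j. ?h (n, j - n)) =
      rr_term 1 j * euler_sum (1 + j) + y * q * (rr_term 2 j * euler_sum (1 + j))" for j
  proof -
    have "?h (n, j - n) = q ^ (j * j + j) * y ^ j * euler_sum (Suc j) *
        ((y * q\<^sup>2) ^ n * q ^ (n choose 2) * rq n * rq (j - n))" if le: "n \<le> j" for n
    proof -
      have d: "n + (j - n) = j" "2 * n + (j - n) = j + n" using le by simp_all
      show ?thesis
        unfolding prod.case d by (simp add: power_add power_mult_distrib mult_ac flip: power_mult)
    qed
    \<comment> \<open>With \<open>n + k = j\<close> fixed, the sum over \<open>n\<close> is the
      q-binomial theorem at \<open>a = y * q\<^sup>2\<close>.\<close>
    then have "(\<Sum>n\<le>j. ?h (n, j - n)) = q ^ (j * j + j) * y ^ j * euler_sum (Suc j) *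
        (qpochhammer (- (y * q\<^sup>2)) q j * rq j)"
      unfolding q_binomial[symmetric] sum_distrib_left by (intro sum.cong) auto
    \<comment> \<open>The prefactor of the theorem supplies the missing first factor of
      (-yq;q)_{j+1}. Its last factor \<open>1 + y * q ^ Suc j\<close> then yields the two
      sums.\<close>
    then have "(1 + y * q) * (\<Sum>n\<le>j. ?h (n, j - n)) =
        q ^ (j * j + j) * y ^ j * euler_sum (Suc j) * qpochhammer (- (y * q)) q (Suc j) * rq j"
      unfolding qpochhammer_Suc_shift by (simp add: power2_eq_square mult_ac)
    also have "\<dots> = rr_term 1 j * euler_sum (1 + j) + y * q * (rr_term 2 j * euler_sum (1 + j))"
      unfolding qpochhammer_Suc by (simp add: rr_term_def power_add algebra_simps mult_2_right)
    finally show ?thesis .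
  qed
  moreover have "((\<lambda>j. rr_term 1 j * euler_sum (1 + j) + y * q * (rr_term 2 j * euler_sum (1 + j)))
      has_sum rr_sum 1 1 + y * q * rr_sum 2 1) UNIV"
    by (intro has_sum_add has_sum_cmult_right has_sum_rr)
  ultimately show ?thesis
    by (simp add: has_sum_unique)
qed

theorem theorem1p2:
  shows "GF \<Lambda>_no_1R (y\<^sup>2) y y = (1 + y * q) * T (y\<^sup>2 * q ^ 4) (y * q\<^sup>2) (y * q)"
proof -
  have "GF \<Lambda>_no_1R (y\<^sup>2) y y = rr_sum 0 1"
    using G_eq_rr_sum[of 0] by (simp add: \<Lambda>_no_1R_eq G\<^sub>D_def)
  \<comment> \<open>By \<open>rr_sum_euler\<close>, the bracket in \<open>rr_sum_step\<close>
    recombines to \<open>rr_sum 2 1\<close>.\<close>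
  also have "\<dots> = rr_sum 1 1 + y * q * rr_sum 2 1"
    using rr_sum_step[of 0 1] rr_sum_euler[of 2 1] by (simp add: numeral_3_eq_3 numeral_2_eq_2)
  finally show ?thesis
    by (simp add: T_eq_rr_sum)
qed

end
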